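(* Let $M$ be a compact, connected and locally connected metric space without isolated points, and let $f:M\to M$ be an expansive homeomorphism. Let $d$ be a metric on $M$ defining the topology of $M$, and let $k>1$, $\varepsilon_0>0$ be numbers, such that $f$ and $f^{-1}$ are Lipschitz for $d$ and $$\max\{d(f(x),f(y)),\,d(f^{-1}(x),f^{-1}(y))\}\ \geq\ \min\{k\,d(x,y),\varepsilon_0\}\qquad\text{for all }x,y\in M .$$ Let $\gamma=\log k$, and let $\Lambda^+(x)$ and $\lambda^+(x)$ be the Lyapunov exponents of $f$ at $x$ computed with respect to the metric $d$. Then for all $x\in M$ one has $\Lambda^+(x)\geq\gamma$ and $\lambda^+(x)\leq-\gamma$.
   Context: A homeomorphism $f:M\to M$ of a compact metric space $(M,\mathrm{dist})$ is expansive if there is $\alpha>0$ such that for all $x\neq y$ in $M$ there is $n\in\mathbb{Z}$ with $\mathrm{dist}(f^n(x),f^n(y))>\alpha$ (this property does not depend on the compatible metric chosen). It is a known theorem (Fathi) that for every expansive homeomorphism $f$ of a compact metric space there exist a compatible metric $d$ and numbers $k>1$, $\varepsilon_0>0$ with the properties listed in the claim. Lyapunov exponents with respect to $d$: for $x\in M$, $\delta>0$ and $n\geq 1$ put $$B^*_x(\delta,n)=\{y\in M\setminus\{x\} : d(f^j(x),f^j(y))\leq\delta \text{ for } j=0,1,\dots,n\},$$ $$A_\delta(x,n)=\sup_{y\in B^*_x(\delta,n)}\frac{d(f^n(x),f^n(y))}{d(x,y)},\qquad a_\delta(x,n)=\inf_{y\in B^*_x(\delta,n)}\frac{d(f^n(x),f^n(y))}{d(x,y)}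 .$$ (These sets are nonempty because $M$ has no isolated points.) Define $$\Lambda^+_\delta(x)=\limsup_{n\to+\infty}\tfrac1n\log A_\delta(x,n),\qquad \lambda^+_\delta(x)=\limsup_{n\to+\infty}\tfrac1n\log a_\delta(x,n),$$ and $\Lambda^+(x)=\lim_{\delta\to0}\Lambda^+_\delta(x)$, $\lambda^+(x)=\lim_{\delta\to0}\lambda^+_\delta(x)$ (limits as $\delta\to 0^+$, which exist by monotonicity in $\delta$). *)

theory Defs
  imports "HOL-Analysis.Analysis"
begin

text \<open>Integer iterates \<open>f\<^sup>n\<close> of a bijection; \<open>inv\<close> is the Hilbert-choice inverse, so for
  non-bijective \<open>f\<close> the negative iterates carry no meaning.\<close>

definition int_iterate :: "('a \<Rightarrow> 'a) \<Rightarrow> int \<Rightarrow> 'a \<Rightarrow> 'a" where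
  "int_iterate f n = (if 0 \<le> n then f ^^ nat n else inv f ^^ nat (- n))"

definition expansive :: "('a::metric_space \<Rightarrow> 'a) \<Rightarrow> bool" where
  "expansive f \<longleftrightarrow>
     (\<exists>\<alpha>>0. \<forall>x y. x \<noteq> y \<longrightarrow> (\<exists>n. dist (int_iterate f n x) (int_iterate f n y) > \<alpha>))"

text \<open>The exponents are taken with respect to an arbitrary distance function \<open>d\<close>, which need not
  be \<open>dist\<close>.\<close>

definition Bstar :: "('a \<Rightarrow> 'a \<Rightarrow> real) \<Rightarrow> ('a \<Rightarrow> 'a) \<Rightarrow> 'a \<Rightarrow> real \<Rightarrow> nat \<Rightarrow> 'a set" where
  "Bstar d f x \<delta> n = {y. y \<noteq> x \<and> (\<forall>j\<le>n. d ((f ^^ j) x) ((f ^^ j) y) \<le> \<delta>)}"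

text \<open>The next two use \<open>Sup\<close> and \<open>Inf\<close> in \<open>real\<close>, which are meaningful for nonempty bounded sets
  only. If \<open>f\<close> and its inverse are Lipschitz for \<open>d\<close>, the quotients lie between \<open>K\<^sup>-\<^sup>n\<close> and \<open>K\<^sup>n\<close>
  for some \<open>K > 0\<close>; the set \<open>Bstar d f x \<delta> n\<close> is nonempty for \<open>\<delta> > 0\<close> when \<open>f\<close> is continuous
  and there are no isolated points.\<close>

definition A_sup :: "('a \<Rightarrow> 'a \<Rightarrow> real) \<Rightarrow> ('a \<Rightarrow> 'a) \<Rightarrow> real \<Rightarrow> 'a \<Rightarrow> nat \<Rightarrow> real" where
  "A_sup d f \<delta> x n = (SUP y\<in>Bstar d f x \<delta> n. d ((f ^^ n) x) ((f ^^ n) y) / d x y)"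

definition a_inf :: "('a \<Rightarrow> 'a \<Rightarrow> real) \<Rightarrow> ('a \<Rightarrow> 'a) \<Rightarrow> real \<Rightarrow> 'a \<Rightarrow> nat \<Rightarrow> real" where
  "a_inf d f \<delta> x n = (INF y\<in>Bstar d f x \<delta> n. d ((f ^^ n) x) ((f ^^ n) y) / d x y)"

definition max_exponent_at :: "('a \<Rightarrow> 'a \<Rightarrow> real) \<Rightarrow> ('a \<Rightarrow> 'a) \<Rightarrow> real \<Rightarrow> 'a \<Rightarrow> ereal" where
  "max_exponent_at d f \<delta> x = limsup (\<lambda>n. ereal (1 / real n * ln (A_sup d f \<delta> x n)))"

text \<open>Also the minimal exponent is defined by an upper limit in \<open>n\<close>.\<close>

definition min_exponent_at :: "('a \<Rightarrow> 'a \<Rightarrow> real) \<Rightarrow> ('a \<Rightarrow> 'a) \<Rightarrow> real \<Rightarrow> 'a \<Rightarrow> ereal" where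
  "min_exponent_at d f \<delta> x = limsup (\<lambda>n. ereal (1 / real n * ln (a_inf d f \<delta> x n)))"

definition max_exponent :: "('a \<Rightarrow> 'a \<Rightarrow> real) \<Rightarrow> ('a \<Rightarrow> 'a) \<Rightarrow> 'a \<Rightarrow> ereal" where
  "max_exponent d f x = Lim (at_right 0) (\<lambda>\<delta>. max_exponent_at d f \<delta> x)"

definition min_exponent :: "('a \<Rightarrow> 'a \<Rightarrow> real) \<Rightarrow> ('a \<Rightarrow> 'a) \<Rightarrow> 'a \<Rightarrow> ereal" where
  "min_exponent d f x = Lim (at_right 0) (\<lambda>\<delta>. min_exponent_at d f \<delta> x)"

end

theory Submission
  imports Defs
begin

text \<open>Along a pair of orbits the hyperbolicity inequality makes the distances \<open>a\<^sub>j\<close> convex at small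
  scales: \<open>k * a\<^sub>j\<close> is at most the larger of \<open>a\<^sub>j\<^sub>-\<^sub>1\<close> and \<open>a\<^sub>j\<^sub>+\<^sub>1\<close>. So a forward orbit that stays
  close to that of \<open>x\<close> contracts at rate \<open>1/k\<close>, and both bounds follow once every point has, at every
  small distance \<open>\<epsilon>\<close>, a companion whose forward orbit stays \<open>\<epsilon>\<close>-close: applied to \<open>f\<close> at \<open>x\<close> this
  bounds the minimal exponent, applied to the inverse at \<open>f\<^sup>n x\<close> it bounds the maximal one.
  The companion exists because no point is Lyapunov stable for the inverse, so that small connected
  neighbourhoods of \<open>f\<^sup>n x\<close> must grow to size \<open>\<epsilon>\<close> under backward iteration, and by convexity the
  first pair at distance \<open>\<epsilon>\<close> is reached at the end of the orbit segment, that is at \<open>x\<close>.\<close>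

section \<open>Bounded sequences with discrete convexity\<close>

text \<open>If contraction fails once, \<open>a j < k * a (Suc j)\<close>, the maximum in
  \<open>step\<close> must be the later term. The failure then passes to the next index, and the
  resulting geometric growth exceeds the bound \<open>e\<close>.\<close>

lemma bounded_growth_imp_decay:
  fixes a :: "nat \<Rightarrow> real"
  assumes k: "k > 1"
    and bounds: "\<And>j. 0 \<le> a j" "\<And>j. a j \<le> e"
    and step: "\<And>j. k * a (Suc j) \<le> max (a (Suc (Suc j))) (a j)"
  shows "a j \<le> a 0 / k ^ j"
proof -
  have decay: "k * a (Suc j) \<le> a j" for j
  proof (rule ccontr)
    assume "\<not> k * a (Suc j) \<le> a j"
    then have lt: "a j < k * a (Suc j)" by simp
    then have pos: "0 < a (Suc j)"
      using bounds(1)[of j] k by (smt (verit) mult_nonneg_nonpos)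
    have grow: "k * a (Suc j + i) \<le> a (Suc (Suc j + i)) \<and> k ^ i * a (Suc j) \<le> a (Suc j + i)" for i
    proof (induction i)
      case 0
      then show ?case using step[of j] lt by simp
    next
      case (Suc i)
      have ge: "k ^ Suc i * a (Suc j) \<le> a (Suc j + Suc i)"
        using Suc.IH k by (smt (verit) add_Suc_right mult.assoc mult_left_mono power_Suc)
      then have pos': "0 < a (Suc j + Suc i)"
        using pos k by (smt (verit) mult_pos_pos zero_less_power)
      have "a (Suc j + i) \<le> k * a (Suc j + i)"
        using k bounds(1)[of "Suc j + i"] by (simp add: mult_le_cancel_right1)
      also have "\<dots> \<le> a (Suc j + Suc i)" using Suc.IH by simp
      also have "\<dots> < k * a (Suc j + Suc i)" using pos' k by simp
      finally show ?case using step[of "Suc j + i"] ge by simp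
    qed
    obtain i where "e / a (Suc j) < k ^ i" using real_arch_pow[OF k] by blast
    then have "e < k ^ i * a (Suc j)" using pos by (simp add: field_simps)
    then show False using grow[of i] bounds(2)[of "Suc j + i"] by linarith
  qed
  show ?thesis
  proof (induction j)
    case (Suc j)
    have "k * a (Suc j) \<le> a 0 / k ^ j" using decay[of j] Suc.IH by simp
    then show ?case using k by (simp add: field_simps)
  qed simp
qed

section \<open>The hyperbolic metric and its topology\<close>

text \<open>The inverse is a parameter \<open>g\<close> of its own: the assumptions are symmetric in
  \<open>f\<close> and \<open>g\<close>, so a second interpretation turns statements on forward
  orbits into statements on backward ones. The metric is a value \<open>m\<close> because only its
  topology is tied to the \<open>dist\<close> of the type.\<close>

locale hyperbolic_homeo =
  fixes m :: "'a::{metric_space, perfect_space} metric"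
    and f g :: "'a \<Rightarrow> 'a" and k e0 :: real
  assumes compact_UNIV: "compact (UNIV :: 'a set)"
    and locally_connected: "locally connected (UNIV :: 'a set)"
    and cont_f: "continuous_on UNIV f" and cont_g: "continuous_on UNIV g"
    and gf [simp]: "g (f x) = x" and fg [simp]: "f (g x) = x"
    and mspace [simp]: "mspace m = UNIV"
    and mtopology: "mtopology_of m = euclidean"
    and k: "k > 1"
    and hyperbolic: "min (k * mdist m x y) e0 \<le> max (mdist m (f x) (f y)) (mdist m (g x) (g y))"
begin

abbreviation d :: "'a \<Rightarrow> 'a \<Rightarrow> real" where "d \<equiv> mdist m"

lemma inverse: "hyperbolic_homeo m g f k e0"
  using compact_UNIV locally_connected cont_f cont_g mtopology k hyperbolic
  by unfold_locales (auto simp: max.commute)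

lemma d_self [simp]: "d x x = 0"
  using mdist_zero[of x m x] by simp

lemma d_pos: "x \<noteq> y \<Longrightarrow> 0 < d x y"
  using mdist_zero[of x m y] mdist_nonneg[of m x y] by (simp add: less_le)

lemma d_triangle: "d x z \<le> d x y + d y z"
  by (simp add: mdist_triangle)

lemma continuous_on_d:
  assumes "continuous_on UNIV u" "continuous_on UNIV v"
  shows "continuous_on UNIV (\<lambda>x. d (u x) (v x))"
  using continuous_map_mdist[of euclidean m u v] assms
  by (simp add: mtopology)

lemma open_imp_ball_subset:
  assumes "open U" "x \<in> U"
  obtains r where "r > 0" "{y. d x y < r} \<subseteq> U"
proof -
  interpret M: Metric_space UNIV d
    using Metric_space_mspace_mdist[of m] by simp
  have "openin M.mtopology U"
    using assms mtopology by (metis mspace mtopology_of_def open_openin)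
  then show thesis
    using assms that by (auto simp: M.openin_mtopology M.mball_def)
qed

lemma continuous_on_funpow: "continuous_on UNIV h \<Longrightarrow> continuous_on UNIV ((h::'a \<Rightarrow> 'a) ^^ n)"
proof (induction n)
  case (Suc n)
  then show ?case
    using continuous_on_compose[of UNIV "h ^^ n" h] continuous_on_subset[of UNIV h] by simp
qed (simp add: id_def)

lemma continuous_on_d_funpow:
  fixes h :: "'a \<Rightarrow> 'a"
  assumes "continuous_on UNIV h"
  shows "continuous_on UNIV (\<lambda>y. d p ((h ^^ n) y))" "continuous_on UNIV (\<lambda>y. d ((h ^^ n) y) p)"
  using continuous_on_funpow[OF assms] by (simp_all add: continuous_on_d)

lemma funpow_fg [simp]: "(f ^^ n) ((g ^^ n) x) = x"
  by (induction n arbitrary: x) (simp_all add: funpow_swap1)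

lemma funpow_fg_le: "j \<le> n \<Longrightarrow> (f ^^ j) ((g ^^ n) x) = (g ^^ (n - j)) x"
  by (metis comp_apply funpow_add funpow_fg le_add_diff_inverse)

lemma convergent_subsequence:
  obtains z r where "strict_mono r" "(\<lambda>i. u (r i :: nat) :: 'a) \<longlonglongrightarrow> z"
  using compact_UNIV unfolding compact_eq_seq_compact_metric seq_compact_def o_def by blast

section \<open>Local stable sets\<close>

text \<open>The local stable set of hyperbolic dynamics; for the inverse map it is the local
  unstable set.\<close>

definition stable_set :: "'a \<Rightarrow> real \<Rightarrow> 'a set" where
  "stable_set x e = {y. \<forall>j. d ((f ^^ j) x) ((f ^^ j) y) \<le> e}"

lemma stable_setD: "y \<in> stable_set x e \<Longrightarrow> d ((f ^^ j) x) ((f ^^ j) y) \<le> e"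
  by (simp add: stable_set_def)

text \<open>At distances up to \<open>e\<close> the cutoff \<open>e0\<close> in
  \<open>hyperbolic\<close> is inactive, because \<open>k * e \<le> e0\<close>. The distances along
  the two orbits are thus a bounded sequence as in \<open>bounded_growth_imp_decay\<close>.\<close>

lemma stable_set_contracts:
  assumes y: "y \<in> stable_set x e" and e: "k * e \<le> e0"
  shows "d ((f ^^ j) x) ((f ^^ j) y) \<le> d x y / k ^ j"
proof -
  have "d ((f ^^ j) x) ((f ^^ j) y) \<le> d ((f ^^ 0) x) ((f ^^ 0) y) / k ^ j"
  proof (rule bounded_growth_imp_decay[OF k])
    fix i
    show le: "d ((f ^^ i) x) ((f ^^ i) y) \<le> e" for i using y by (rule stable_setD)
    have "k * d ((f ^^ Suc i) x) ((f ^^ Suc i) y) \<le> e0"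
      using le[of "Suc i"] e k by (smt (verit) mult_left_mono)
    then show "k * d ((f ^^ Suc i) x) ((f ^^ Suc i) y)
        \<le> max (d ((f ^^ Suc (Suc i)) x) ((f ^^ Suc (Suc i)) y)) (d ((f ^^ i) x) ((f ^^ i) y))"
      using hyperbolic[of "(f ^^ Suc i) x" "(f ^^ Suc i) y"] by simp
  qed simp
  then show ?thesis by simp
qed

lemma closed_stable_set: "closed (stable_set x e)"
proof -
  have "stable_set x e = (\<Inter>j. {y. d ((f ^^ j) x) ((f ^^ j) y) \<le> e})"
    by (auto simp: stable_set_def)
  moreover have "closed {y. d ((f ^^ j) x) ((f ^^ j) y) \<le> e}" for j
    by (intro closed_Collect_le continuous_on_const continuous_on_d_funpow cont_f)
  ultimately show ?thesis by auto
qed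

section \<open>Connected sets and the instability of every point\<close>

text \<open>Used with \<open>F\<close> given by non-strict distance bounds and \<open>U\<close> by
  strict ones: if both have the same trace on \<open>C\<close>, that trace is clopen and
  nonempty.\<close>

lemma connected_subset_clopen:
  assumes "connected C" "open U" "closed F" "C \<inter> U = C \<inter> F" "x \<in> C" "x \<in> F"
  shows "C \<subseteq> F"
proof -
  have "openin (top_of_set C) (C \<inter> F)"
    using assms by (metis openin_open_Int)
  moreover have "closedin (top_of_set C) (C \<inter> F)"
    using assms by (simp add: closedin_closed_Int)
  ultimately show ?thesis
    using assms unfolding connected_clopen by blast
qed

text \<open>A \<open>d\<close>-ball need not be connected; local connectedness shrinks it to a
  neighbourhood that is.\<close>

lemma connected_neighbourhood:
  assumes "e > 0"
  obtains V where "open V" "connected V" "x \<in> V" "\<forall>y\<in>V. d x y < e"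
proof -
  have "open {y. d x y < e}"
    by (intro open_Collect_less continuous_on_const continuous_on_d continuous_on_id)
  then have "\<exists>V. openin (top_of_set UNIV) V \<and> connected V \<and> x \<in> V \<and> V \<subseteq> {y. d x y < e}"
    using assms
    by (intro locally_connected[unfolded Homotopy.locally_connected, rule_format]) simp
  then show thesis
    using that by (auto simp flip: open_openin)
qed

text \<open>Stability near \<open>y\<close> extends to its past at a size \<open>e\<close> that does
  not shrink with \<open>n\<close>. A point of \<open>C\<close> that is stable contracts, so all its
  bounds are strict and it arrives within \<open>e / k ^ n < r\<close> of \<open>y\<close>. This
  makes stability an open condition on \<open>C\<close>, and connectedness does the rest.\<close>

lemma stable_imp_uniform_backward:
  assumes e: "k * e \<le> e0"
    and U: "open U" "y \<in> U" "U \<subseteq> stable_set y e"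
  shows "\<forall>\<^sub>F n in sequentially. \<forall>C. connected C \<longrightarrow> (g ^^ n) y \<in> C \<longrightarrow>
           (\<forall>w\<in>C. d ((g ^^ n) y) w < e) \<longrightarrow> C \<subseteq> stable_set ((g ^^ n) y) e"
proof -
  obtain r where r: "r > 0" "{w. d y w < r} \<subseteq> U"
    using open_imp_ball_subset[OF U(1,2)] .
  have "(\<lambda>n. e / k ^ n) \<longlonglongrightarrow> 0"
    using k by (rule LIMSEQ_divide_realpow_zero)
  then have "\<forall>\<^sub>F n in sequentially. e / k ^ n < r"
    using r by (auto dest: order_tendstoD)
  then show ?thesis
  proof eventually_elim
    case (elim n)
    define z where "z = (g ^^ n) y"
    have fz: "(f ^^ n) z = y" by (simp add: z_def)
    \<comment> \<open>Only times up to \<open>n\<close> are constrained, which keeps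
      \<open>W\<close> open; from time \<open>n\<close> on, stability of \<open>U\<close> around
      \<open>y\<close> takes over.\<close>
    define W where "W = (\<Inter>j\<in>{..n}. {w. d ((f ^^ j) z) ((f ^^ j) w) < e}) \<inter> {w. d y ((f ^^ n) w) < r}"
    have "C \<subseteq> stable_set z e"
      if C: "connected C" "z \<in> C" "\<forall>w\<in>C. d z w < e" for C
    proof (rule connected_subset_clopen[OF C(1) _ closed_stable_set _ C(2)])
      show "open W" unfolding W_def
        by (intro open_Int open_INT open_Collect_less finite_atMost ballI continuous_on_const
            continuous_on_d_funpow cont_f)
      have W_sub: "W \<subseteq> stable_set z e"
      proof
        fix w assume w: "w \<in> W"
        have "d ((f ^^ j) z) ((f ^^ j) w) \<le> e" for j
        proof (cases "j \<le> n")
          case True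
          then show ?thesis using w by (auto simp: W_def less_imp_le)
        next
          case False
          then obtain i where j: "j = i + n" by (metis add.commute le_add_diff_inverse nat_le_linear)
          have "(f ^^ n) w \<in> stable_set y e"
            using w r(2) U(3) by (auto simp: W_def)
          then have "d ((f ^^ i) y) ((f ^^ i) ((f ^^ n) w)) \<le> e" by (rule stable_setD)
          then show ?thesis by (simp add: j funpow_add fz)
        qed
        then show "w \<in> stable_set z e" by (simp add: stable_set_def)
      qed
      have sub_W: "w \<in> W" if w: "w \<in> C" "w \<in> stable_set z e" for w
      proof -
        have zw: "d z w < e" using C w by blast
        have c: "d ((f ^^ j) z) ((f ^^ j) w) \<le> d z w / k ^ j" for j
          by (rule stable_set_contracts[OF w(2) e])
        have "d z w / k ^ j \<le> d z w" for j
          using k divide_left_mono[of 1 "k ^ j" "d z w"] by (simp add: one_le_power)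
        then have "d ((f ^^ j) z) ((f ^^ j) w) < e" for j
          using c[of j] zw by (meson le_less_trans order_trans)
        moreover have "d z w / k ^ n \<le> e / k ^ n"
          using zw k by (intro divide_right_mono) auto
        then have "d y ((f ^^ n) w) < r"
          using c[of n] elim by (simp add: fz)
        ultimately show ?thesis by (simp add: W_def)
      qed
      show "C \<inter> W = C \<inter> stable_set z e" using W_sub sub_W by blast
      have "0 < e" using C by (metis le_less_trans mdist_nonneg)
      then show "z \<in> stable_set z e" by (simp add: stable_set_def)
    qed
    then show ?case by (simp add: z_def)
  qed
qed

text \<open>If all points near \<open>x\<close> were stable, then far back in the past any two of them that lie close
  together would contract up to the present. By compactness, among sufficiently many points of the
  neighbourhood two are close at any given past time.\<close>

lemma no_stable_point:
  assumes e: "0 < e" "k * (2 * e) \<le> e0"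
    and U: "open U" "x \<in> U" "U \<subseteq> stable_set x e"
  shows False
proof -
  \<comment> \<open>Stability is moved from the centre \<open>x\<close> to every other centre in
    \<open>U\<close>; going through \<open>x\<close> doubles the scale.\<close>
  have U2: "U \<subseteq> stable_set y (2 * e)" if y: "y \<in> U" for y
  proof
    fix w assume w: "w \<in> U"
    have "d ((f ^^ j) y) ((f ^^ j) w) \<le> 2 * e" for j
      using stable_setD[of y x e j] stable_setD[of w x e j] U(3) y w
        d_triangle[of "(f ^^ j) y" "(f ^^ j) w" "(f ^^ j) x"] mdist_commute[of m "(f ^^ j) y"]
      by fastforce
    then show "w \<in> stable_set y (2 * e)" by (simp add: stable_set_def)
  qed
  \<comment> \<open>A finite cover by connected sets of radius \<open>e\<close>: two points in one
    of them are less than \<open>2 * e\<close> apart.\<close>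
  have "\<forall>p. \<exists>V. open V \<and> connected V \<and> p \<in> V \<and> (\<forall>y\<in>V. d p y < e)"
    by (rule allI, rule connected_neighbourhood[OF e(1)]) blast
  from choice[OF this]
  obtain V where "\<forall>p. open (V p) \<and> connected (V p) \<and> p \<in> V p \<and> (\<forall>y\<in>V p. d p y < e)" ..
  then have V: "\<And>p. open (V p)" "\<And>p. connected (V p)" "\<And>p. p \<in> V p"
      "\<And>p y. y \<in> V p \<Longrightarrow> d p y < e"
    by auto
  have cover: "UNIV \<subseteq> (\<Union>p\<in>UNIV. V p)" using V(3) by blast
  obtain P where "P \<subseteq> UNIV" and P: "finite P" "UNIV \<subseteq> (\<Union>p\<in>P. V p)"
    by (rule compactE_image[OF compact_UNIV V(1) cover])
  then have "\<forall>z. \<exists>p. p \<in> P \<and> z \<in> V p" by blast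
  then obtain c where c: "\<And>z. c z \<in> P" "\<And>z. z \<in> V (c z)" by metis
  obtain r where r: "r > 0" "ball x r \<subseteq> U" using U openE by blast
  \<comment> \<open>Without isolated points every ball is infinite, so it holds one point more than
    there are covering sets.\<close>
  have "infinite (ball x r)"
    using islimpt_UNIV[of x] r(1) by (simp add: islimpt_eq_infinite_ball)
  then obtain F where F: "F \<subseteq> ball x r" "finite F" "card F = Suc (card P)"
    using infinite_arbitrarily_large by metis
  have FU: "y \<in> U" if "y \<in> F" for y using that F r by blast
  have "(\<lambda>n. 2 * e / k ^ n) \<longlonglongrightarrow> 0"
    using k by (rule LIMSEQ_divide_realpow_zero)
  then have "\<forall>\<^sub>F n in sequentially. y \<noteq> w \<longrightarrow> 2 * e / k ^ n < d y w" for y w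
    using d_pos[of y w] by (cases "y = w") (auto dest: order_tendstoD)
  \<comment> \<open>The finitely many distances within \<open>F\<close> are positive, so a late
    \<open>n\<close> puts the contraction bound below all of them.\<close>
  then have sep: "\<forall>\<^sub>F n in sequentially. \<forall>y\<in>F. \<forall>w\<in>F. y \<noteq> w \<longrightarrow> 2 * e / k ^ n < d y w"
    using F(2) by (intro eventually_ball_finite ballI)
  have "\<forall>\<^sub>F n in sequentially. \<forall>y\<in>F. \<forall>C. connected C \<longrightarrow> (g ^^ n) y \<in> C \<longrightarrow>
          (\<forall>w\<in>C. d ((g ^^ n) y) w < 2 * e) \<longrightarrow> C \<subseteq> stable_set ((g ^^ n) y) (2 * e)"
    using F(2) FU U2 U(1) e(2)
    by (intro eventually_ball_finite ballI stable_imp_uniform_backward[of _ U]) auto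
  with sep have "\<forall>\<^sub>F n in sequentially. False"
  proof eventually_elim
    case (elim n)
    have "\<not> inj_on (\<lambda>y. c ((g ^^ n) y)) F"
    proof (rule pigeonhole)
      have "(\<lambda>y. c ((g ^^ n) y)) ` F \<subseteq> P" using c(1) by blast
      then show "card ((\<lambda>y. c ((g ^^ n) y)) ` F) < card F"
        using P(1) F(3) by (simp add: card_mono less_Suc_eq_le)
    qed
    then obtain y w where yw: "y \<in> F" "w \<in> F" "y \<noteq> w" "c ((g ^^ n) y) = c ((g ^^ n) w)"
      by (auto simp: inj_on_def)
    define p where "p = c ((g ^^ n) y)"
    have yV: "(g ^^ n) y \<in> V p" and wV: "(g ^^ n) w \<in> V p"
      using c(2)[of "(g ^^ n) y"] c(2)[of "(g ^^ n) w"] yw(4) by (simp_all add: p_def)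
    have near: "d ((g ^^ n) y) v < 2 * e" if "v \<in> V p" for v
      using V(4)[OF that] V(4)[OF yV] d_triangle[of "(g ^^ n) y" v p] mdist_commute[of m _ p] by fastforce
    \<comment> \<open>The connected set \<open>V p\<close> joins the two past points and stays
      within \<open>2 * e\<close> of the first, so the backward lemma applies to it.\<close>
    then have st: "(g ^^ n) w \<in> stable_set ((g ^^ n) y) (2 * e)"
      using elim(2) yw(1) V(2) yV wV by blast
    have "d y w \<le> d ((g ^^ n) y) ((g ^^ n) w) / k ^ n"
      using stable_set_contracts[OF st e(2), of n] by simp
    also have "\<dots> \<le> 2 * e / k ^ n"
      using near[OF wV] k by (intro divide_right_mono) auto
    finally show False using elim(1) yw by fastforce
  qed
  then show False by simp
qed

section \<open>Companions at a prescribed distance\<close>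

text \<open>Without such a point, a small connected set around a late iterate of \<open>x\<close>
  never reaches distance \<open>e\<close> under backward iteration. At an accumulation point of the
  forward orbit this gives stability for the inverse, which \<open>no_stable_point\<close>
  excludes.\<close>

lemma finite_time_stable_point:
  assumes e: "0 < e" "k * (2 * e) \<le> e0"
  shows "\<exists>w. d x w = e \<and> (\<forall>j\<le>n. d ((f ^^ j) x) ((f ^^ j) w) \<le> e)"
proof (rule ccontr)
  assume none: "\<not> ?thesis"
  interpret inv: hyperbolic_homeo m g f k e0 by (rule inverse)
  \<comment> \<open>Passing to an accumulation point lets one neighbourhood \<open>V\<close> serve
    arbitrarily long orbit segments.\<close>
  obtain z r where r: "strict_mono r" and z: "(\<lambda>i. (f ^^ r i) x) \<longlonglongrightarrow> z"
    using convergent_subsequence[of "\<lambda>i. (f ^^ i) x"] .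
  \<comment> \<open>Radius \<open>e / 2\<close> makes any two points of \<open>V\<close> less than
    \<open>e\<close> apart.\<close>
  have half: "0 < e / 2" using e by simp
  obtain V where V: "open V" "connected V" "z \<in> V" and near_z: "\<forall>y\<in>V. d z y < e / 2"
    using connected_neighbourhood[OF half, of z] .
  have "V \<subseteq> inv.stable_set z e"
  proof
    fix y assume y: "y \<in> V"
    have "d ((g ^^ j) z) ((g ^^ j) y) \<le> e" for j
    proof (rule tendsto_upperbound)
      show "((\<lambda>i. d ((g ^^ j) ((f ^^ r i) x)) ((g ^^ j) y)) \<longlongrightarrow> d ((g ^^ j) z) ((g ^^ j) y)) sequentially"
        using continuous_on_tendsto_compose[OF continuous_on_d_funpow(2)[OF cont_g] z] by simp
      have "\<forall>\<^sub>F i in sequentially. (f ^^ r i) x \<in> V"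
        using z V(1,3) by (rule topological_tendstoD)
      \<comment> \<open>The segment must have length at least \<open>n\<close>, for the
        contradiction with \<open>none\<close>, and at least \<open>j\<close>, to control time
        \<open>j\<close>.\<close>
      moreover have "\<forall>\<^sub>F i in sequentially. max n j \<le> i" by (rule eventually_ge_at_top)
      ultimately show "\<forall>\<^sub>F i in sequentially. d ((g ^^ j) ((f ^^ r i) x)) ((g ^^ j) y) \<le> e"
      proof eventually_elim
        case (elim i)
        define q where "q = (f ^^ r i) x"
        define N where "N = r i"
        have N: "n \<le> N" "j \<le> N"
          using elim(2) seq_suble[OF r, of i] by (auto simp: N_def)
        \<comment> \<open>Strict and non-strict closeness up to time \<open>N\<close>; the traces on
          \<open>V\<close> agree if no point of \<open>V\<close> in \<open>F1\<close> attains
          \<open>e\<close>.\<close>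
        define O1 where "O1 = (\<Inter>l\<in>{..N}. {y. d ((g ^^ l) q) ((g ^^ l) y) < e})"
        define F1 where "F1 = (\<Inter>l\<in>{..N}. {y. d ((g ^^ l) q) ((g ^^ l) y) \<le> e})"
        have "V \<subseteq> F1"
        proof (rule connected_subset_clopen[OF V(2)])
          show "open O1" unfolding O1_def
            by (intro open_INT open_Collect_less finite_atMost ballI continuous_on_const
                continuous_on_d_funpow cont_g)
          show "closed F1" unfolding F1_def
            by (intro closed_INT closed_Collect_le ballI continuous_on_const
                continuous_on_d_funpow cont_g)
          show "q \<in> V" using elim(1) by (simp add: q_def)
          then have near: "d q w < e" if "w \<in> V" for w
            using bspec[OF near_z that] bspec[OF near_z, of q] d_triangle[of q w z] mdist_commute[of m q z] by simp
          show "q \<in> F1" using e by (simp add: F1_def)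
          have "w \<in> O1" if w: "w \<in> V" "w \<in> F1" for w
          proof (rule ccontr)
            define a where "a l = d ((g ^^ l) q) ((g ^^ l) w)" for l
            have le: "a l \<le> e" if "l \<le> N" for l using w that by (auto simp: F1_def a_def)
            assume "w \<notin> O1"
            then obtain l where l: "l \<le> N" "a l = e"
              using le by (force simp: O1_def a_def)
            \<comment> \<open>An interior maximum \<open>a l = e\<close> contradicts convexity; \<open>l = N\<close> would give the point
              excluded by \<open>none\<close>.\<close>
            have "l \<noteq> 0" using l(2) near[OF w(1)] by (cases l) (auto simp: a_def)
            moreover have "l \<noteq> N"
            proof
              assume "l = N"
              have x: "(g ^^ N) q = x" by (simp add: q_def N_def inv.funpow_fg)
              have "d ((f ^^ i) x) ((f ^^ i) ((g ^^ N) w)) \<le> e" if "i \<le> n" for i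
              proof -
                have "(f ^^ i) x = (g ^^ (N - i)) q"
                  using that N x funpow_fg_le[of i N q] by simp
                then show ?thesis
                  using that N le[of "N - i"] by (simp add: funpow_fg_le a_def)
              qed
              moreover have "d x ((g ^^ N) w) = e"
                using l \<open>l = N\<close> x by (simp add: a_def)
              ultimately show False using none by blast
            qed
            ultimately obtain b where b: "l = Suc b" "Suc l \<le> N"
              using l(1) by (metis Suc_leI le_neq_implies_less old.nat.exhaust)
            have "min (k * a l) e0 \<le> max (a b) (a (Suc l))"
              using hyperbolic[of "(g ^^ l) q" "(g ^^ l) w"] by (simp add: a_def b(1))
            then have "min (k * e) e0 \<le> e"
              using le[of b] le[of "Suc l"] b l(2) by simp
            moreover have "e < k * e" "k * e < k * (2 * e)" using k e by auto
            ultimately show False using e(2) by linarith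
          qed
          then show "V \<inter> O1 = V \<inter> F1" by (auto simp: O1_def F1_def less_imp_le)
        qed
        then show ?case using y N by (auto simp: F1_def q_def)
      qed
    qed simp
    then show "y \<in> inv.stable_set z e" by (simp add: inv.stable_set_def)
  qed
  then show False using inv.no_stable_point[OF e V(1,3)] by blast
qed

text \<open>A limit of finite-time companions: the bound at time \<open>j\<close> holds from index
  \<open>j\<close> on, and the exact distance \<open>e\<close> survives the limit, so the companion
  does not collapse to \<open>x\<close>.\<close>

lemma stable_point_exists:
  assumes e: "0 < e" "k * (2 * e) \<le> e0"
  obtains w where "d x w = e" "w \<in> stable_set x e"
proof -
  obtain w where w: "\<And>n. d x (w n) = e" "\<And>n j. j \<le> n \<Longrightarrow> d ((f ^^ j) x) ((f ^^ j) (w n)) \<le> e"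
    using finite_time_stable_point[OF e, of x] by metis
  obtain z r where r: "strict_mono r" and z: "(\<lambda>i. w (r i)) \<longlonglongrightarrow> z"
    using convergent_subsequence[of w] .
  have lim: "(\<lambda>i. d ((f ^^ j) x) ((f ^^ j) (w (r i)))) \<longlonglongrightarrow> d ((f ^^ j) x) ((f ^^ j) z)" for j
    using continuous_on_tendsto_compose[OF continuous_on_d_funpow(1)[OF cont_f] z] by simp
  have "d x z = e"
    using lim[of 0] w(1) by (simp add: LIMSEQ_const_iff)
  moreover have "d ((f ^^ j) x) ((f ^^ j) z) \<le> e" for j
  proof (rule LIMSEQ_le_const2[OF lim])
    show "\<exists>N. \<forall>i\<ge>N. d ((f ^^ j) x) ((f ^^ j) (w (r i))) \<le> e"
      using w(2) seq_suble[OF r] by (meson order_trans)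
  qed
  ultimately show thesis using that by (simp add: stable_set_def)
qed

end

section \<open>Monotone one-sided limits\<close>

text \<open>\<open>Lim\<close> is informative only once convergence is known; this lemma and its
  dual identify the limits defining the exponents.\<close>

lemma mono_on_tendsto_at_right_INF:
  fixes h :: "real \<Rightarrow> ereal"
  assumes "\<And>s t. a < s \<Longrightarrow> s \<le> t \<Longrightarrow> h s \<le> h t"
  shows "(h \<longlongrightarrow> (INF t\<in>{a<..}. h t)) (at_right a)"
proof (rule decreasing_tendsto)
  show "\<forall>\<^sub>F t in at_right a. (INF t\<in>{a<..}. h t) \<le> h t"
    using eventually_at_right_less[of a] by (rule eventually_mono) (auto intro: INF_lower)
  fix c assume "(INF t\<in>{a<..}. h t) < c"
  then obtain t where "a < t" "h t < c" by (auto simp: INF_less_iff)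
  then show "\<forall>\<^sub>F t in at_right a. h t < c"
    using assms unfolding eventually_at_right_field by (meson le_less_trans less_imp_le)
qed

lemma antimono_on_tendsto_at_right_SUP:
  fixes h :: "real \<Rightarrow> ereal"
  assumes "\<And>s t. a < s \<Longrightarrow> s \<le> t \<Longrightarrow> h t \<le> h s"
  shows "(h \<longlongrightarrow> (SUP t\<in>{a<..}. h t)) (at_right a)"
proof (rule increasing_tendsto)
  show "\<forall>\<^sub>F t in at_right a. h t \<le> (SUP t\<in>{a<..}. h t)"
    using eventually_at_right_less[of a] by (rule eventually_mono) (auto intro: SUP_upper)
  fix c assume "c < (SUP t\<in>{a<..}. h t)"
  then obtain t where "a < t" "c < h t" by (auto simp: less_SUP_iff)
  then show "\<forall>\<^sub>F t in at_right a. c < h t"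
    using assms unfolding eventually_at_right_field by (meson less_le_trans less_imp_le)
qed

section \<open>Extremal ratios over finite orbit segments\<close>

locale lipschitz_hyperbolic_homeo = hyperbolic_homeo +
  assumes e0: "e0 > 0"
    and lipschitz_f: "Lipschitz_continuous_map m m f"
    and lipschitz_g: "Lipschitz_continuous_map m m g"
begin

lemma lipschitz_funpow:
  assumes "Lipschitz_continuous_map m m h"
  obtains L where "L > 0" "\<And>n x y. d ((h ^^ n) x) ((h ^^ n) y) \<le> L ^ n * d x y"
proof -
  obtain L where L: "L > 0" "\<And>x y. d (h x) (h y) \<le> L * d x y"
    using assms by (auto simp: Lipschitz_continuous_map_pos)
  have "d ((h ^^ n) x) ((h ^^ n) y) \<le> L ^ n * d x y" for n x y
  proof (induction n)
    case (Suc n)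
    have "d ((h ^^ Suc n) x) ((h ^^ Suc n) y) \<le> L * d ((h ^^ n) x) ((h ^^ n) y)"
      using L(2) by simp
    also have "\<dots> \<le> L * (L ^ n * d x y)"
      using Suc.IH L(1) by (simp add: mult_left_mono)
    finally show ?case by (simp add: mult.assoc)
  qed simp
  then show thesis using L(1) that by blast
qed

abbreviation ratio :: "'a \<Rightarrow> nat \<Rightarrow> 'a \<Rightarrow> real" where
  "ratio x n y \<equiv> d ((f ^^ n) x) ((f ^^ n) y) / d x y"

text \<open>Makes the real \<open>SUP\<close> in \<open>A_sup\<close> a genuine supremum.\<close>

lemma bdd_above_ratio: "bdd_above (ratio x n ` Bstar d f x t n)"
proof -
  obtain L where L: "\<And>n x y. d ((f ^^ n) x) ((f ^^ n) y) \<le> L ^ n * d x y"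
    using lipschitz_funpow[OF lipschitz_f] by metis
  show ?thesis
  proof (intro bdd_aboveI2)
    fix y assume "y \<in> Bstar d f x t n"
    then have "0 < d x y" by (auto simp: Bstar_def intro: d_pos)
    then show "ratio x n y \<le> L ^ n" using L by (simp add: pos_divide_le_eq)
  qed
qed

lemma bdd_below_ratio: "bdd_below (ratio x n ` Bstar d f x t n)"
  by (rule bdd_belowI2[where m = 0]) simp

text \<open>The Lipschitz constant of the inverse keeps the infimum \<open>a_inf\<close> positive,
  where \<open>ln\<close> is monotone.\<close>

lemma ratio_lower_bound:
  obtains c where "\<And>n. 0 < c n" "\<And>x n t y. y \<in> Bstar d f x t n \<Longrightarrow> c n \<le> ratio x n y"
proof -
  obtain L where L: "L > 0" "\<And>n x y. d ((g ^^ n) x) ((g ^^ n) y) \<le> L ^ n * d x y"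
    using lipschitz_funpow[OF lipschitz_g] by metis
  interpret inv: hyperbolic_homeo m g f k e0 by (rule inverse)
  show thesis
  proof (rule that[of "\<lambda>n. 1 / L ^ n"])
    show "0 < 1 / L ^ n" for n using L by simp
    fix x n t y assume "y \<in> Bstar d f x t n"
    then have "0 < d x y" by (auto simp: Bstar_def intro: d_pos)
    moreover have "d x y \<le> L ^ n * d ((f ^^ n) x) ((f ^^ n) y)"
      using L(2)[of n "(f ^^ n) x" "(f ^^ n) y"] by (simp add: inv.funpow_fg)
    ultimately show "1 / L ^ n \<le> ratio x n y"
      using L(1) by (simp add: field_simps)
  qed
qed

text \<open>The factor 2 is the one required by \<open>stable_point_exists\<close>;
  \<open>e0 / (2 * k)\<close> is the largest scale it permits.\<close>

lemma small_scale:
  assumes "0 < t"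
  obtains e where "0 < e" "e \<le> t" "k * (2 * e) \<le> e0"
proof (rule that[of "min t (e0 / (2 * k))"])
  have "k * (2 * min t (e0 / (2 * k))) \<le> k * (2 * (e0 / (2 * k)))"
    using k by (intro mult_left_mono) auto
  then show "k * (2 * min t (e0 / (2 * k))) \<le> e0" using k by simp
qed (use assms k e0 in auto)

text \<open>The companion of \<open>x\<close> in its local stable set, at a scale below
  \<open>t\<close>.\<close>

lemma contracted_witness:
  assumes "0 < t"
  obtains y where "y \<in> Bstar d f x t n" "ratio x n y \<le> 1 / k ^ n"
proof -
  obtain e where e: "0 < e" "e \<le> t" "k * (2 * e) \<le> e0" using small_scale[OF assms] .
  obtain y where y: "d x y = e" "y \<in> stable_set x e" using stable_point_exists[OF e(1,3)] .
  have "k * e \<le> e0" using e k by (smt (verit) mult_left_mono)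
  then have "d ((f ^^ n) x) ((f ^^ n) y) \<le> d x y / k ^ n" by (rule stable_set_contracts[OF y(2)])
  then have "ratio x n y \<le> 1 / k ^ n"
    using y(1) e(1) by (simp add: field_simps)
  moreover have "y \<in> Bstar d f x t n"
    using y e stable_setD[OF y(2)] by (auto simp: Bstar_def intro: order_trans)
  ultimately show thesis using that by blast
qed

text \<open>A companion \<open>w\<close> of \<open>f^n x\<close> for the inverse contracts backwards
  by \<open>k ^ n\<close>; its preimage \<open>y\<close> is therefore expanded by that factor, and
  the pair stays close along the whole segment.\<close>

lemma expanded_witness:
  assumes "0 < t"
  obtains y where "y \<in> Bstar d f x t n" "k ^ n \<le> ratio x n y"
proof -
  interpret inv: hyperbolic_homeo m g f k e0 by (rule inverse)
  obtain e where e: "0 < e" "e \<le> t" "k * (2 * e) \<le> e0" using small_scale[OF assms] .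
  define q where "q = (f ^^ n) x"
  have qx: "(g ^^ n) q = x" by (simp add: q_def inv.funpow_fg)
  obtain w where w: "d q w = e" "w \<in> inv.stable_set q e" using inv.stable_point_exists[OF e(1,3)] .
  define y where "y = (g ^^ n) w"
  have ny: "(f ^^ n) y = w" by (simp add: y_def)
  have "y \<noteq> x"
    using w(1) e(1) ny by (auto simp: q_def)
  have "k * e \<le> e0" using e k by (smt (verit) mult_left_mono)
  then have "d x y \<le> e / k ^ n"
    using inv.stable_set_contracts[OF w(2), of n] w(1) by (simp add: qx y_def)
  moreover have "0 < d x y" using \<open>y \<noteq> x\<close> by (metis d_pos)
  ultimately have "k ^ n \<le> ratio x n y"
    using k w(1) ny by (simp add: field_simps q_def)
  moreover have "d ((f ^^ j) x) ((f ^^ j) y) \<le> t" if "j \<le> n" for j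
  proof -
    have "(f ^^ j) x = (g ^^ (n - j)) q" using funpow_fg_le[OF that, of q] by (simp add: qx)
    moreover have "(f ^^ j) y = (g ^^ (n - j)) w" using funpow_fg_le[OF that, of w] by (simp add: y_def)
    ultimately show ?thesis using inv.stable_setD[OF w(2), of "n - j"] e by simp
  qed
  ultimately show thesis using that[of y] \<open>y \<noteq> x\<close> by (simp add: Bstar_def)
qed

lemma Bstar_nonempty: "0 < t \<Longrightarrow> Bstar d f x t n \<noteq> {}"
  using contracted_witness by (metis empty_iff)

lemma Bstar_mono: "s \<le> t \<Longrightarrow> Bstar d f x s n \<subseteq> Bstar d f x t n"
  by (auto simp: Bstar_def intro: order_trans)

lemma A_sup_ge:
  assumes "0 < t"
  shows "k ^ n \<le> A_sup d f t x n"
proof -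
  obtain y where y: "y \<in> Bstar d f x t n" "k ^ n \<le> ratio x n y" using expanded_witness[OF assms] .
  then show ?thesis
    unfolding A_sup_def using cSUP_upper[OF y(1) bdd_above_ratio] by linarith
qed

lemma a_inf_le:
  assumes "0 < t"
  shows "a_inf d f t x n \<le> 1 / k ^ n"
proof -
  obtain y where y: "y \<in> Bstar d f x t n" "ratio x n y \<le> 1 / k ^ n" using contracted_witness[OF assms] .
  then show ?thesis
    unfolding a_inf_def using cINF_lower[OF bdd_below_ratio y(1)] by linarith
qed

lemma a_inf_pos:
  assumes "0 < t"
  shows "0 < a_inf d f t x n"
proof -
  obtain c where c: "\<And>n. 0 < c n" "\<And>x n t y. y \<in> Bstar d f x t n \<Longrightarrow> c n \<le> ratio x n y"
    using ratio_lower_bound by metis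
  have "c n \<le> a_inf d f t x n"
    unfolding a_inf_def by (rule cINF_greatest[OF Bstar_nonempty[OF assms] c(2)])
  then show ?thesis using c(1)[of n] by linarith
qed

lemma A_sup_pos: "0 < t \<Longrightarrow> 0 < A_sup d f t x n"
  using A_sup_ge[of t n x] k by (smt (verit) zero_less_power)

lemma A_sup_mono: "0 < s \<Longrightarrow> s \<le> t \<Longrightarrow> A_sup d f s x n \<le> A_sup d f t x n"
  unfolding A_sup_def
  by (intro cSUP_subset_mono Bstar_nonempty bdd_above_ratio Bstar_mono order_refl)

lemma a_inf_antimono: "0 < s \<Longrightarrow> s \<le> t \<Longrightarrow> a_inf d f t x n \<le> a_inf d f s x n"
  unfolding a_inf_def
  by (intro cINF_superset_mono Bstar_nonempty bdd_below_ratio Bstar_mono order_refl)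

section \<open>Exponents at a fixed scale and their limits\<close>

lemma max_exponent_at_mono:
  assumes "0 < s" "s \<le> t"
  shows "max_exponent_at d f s x \<le> max_exponent_at d f t x"
  unfolding max_exponent_at_def
proof (intro Limsup_mono always_eventually allI)
  \<comment> \<open>At \<open>n = 0\<close> both sides are 0, since
    \<open>1 / real 0 = 0\<close>.\<close>
  fix n
  show "ereal (1 / real n * ln (A_sup d f s x n)) \<le> ereal (1 / real n * ln (A_sup d f t x n))"
    using A_sup_mono[OF assms, of x n] A_sup_pos[OF assms(1), of x n]
    by (auto intro!: divide_right_mono)
qed

lemma min_exponent_at_antimono:
  assumes "0 < s" "s \<le> t"
  shows "min_exponent_at d f t x \<le> min_exponent_at d f s x"
  unfolding min_exponent_at_def
proof (intro Limsup_mono always_eventually allI)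
  fix n
  show "ereal (1 / real n * ln (a_inf d f t x n)) \<le> ereal (1 / real n * ln (a_inf d f s x n))"
    using a_inf_antimono[OF assms, of x n] a_inf_pos[of t x n] assms
    by (auto intro!: divide_right_mono)
qed

lemma max_exponent_at_ge:
  assumes "0 < t"
  shows "ereal (ln k) \<le> max_exponent_at d f t x"
proof -
  have "ereal (ln k) \<le> ereal (1 / real n * ln (A_sup d f t x n))" if "0 < n" for n
  proof -
    have "ln (k ^ n) \<le> ln (A_sup d f t x n)"
      using A_sup_ge[OF assms, of n x] k A_sup_pos[OF assms, of x n] by simp
    then show ?thesis using k that by (simp add: ln_realpow field_simps)
  qed
  \<comment> \<open>The bound fails at \<open>n = 0\<close>, where the right side is 0 and
    \<open>ln k > 0\<close>.\<close>
  then have "\<forall>\<^sub>F n in sequentially. ereal (ln k) \<le> ereal (1 / real n * ln (A_sup d f t x n))"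
    using eventually_gt_at_top[of "0::nat"] by (rule eventually_mono[rotated])
  then have "limsup (\<lambda>n. ereal (ln k)) \<le> max_exponent_at d f t x"
    unfolding max_exponent_at_def by (rule Limsup_mono)
  then show ?thesis by (simp add: Limsup_const)
qed

lemma min_exponent_at_le:
  assumes "0 < t"
  shows "min_exponent_at d f t x \<le> ereal (- ln k)"
  unfolding min_exponent_at_def
proof (rule Limsup_bounded)
  have "ereal (1 / real n * ln (a_inf d f t x n)) \<le> ereal (- ln k)" if "0 < n" for n
  proof -
    have "ln (a_inf d f t x n) \<le> ln (1 / k ^ n)"
      using a_inf_le[OF assms, of x n] k a_inf_pos[OF assms, of x n] by simp
    then show ?thesis using k that by (simp add: ln_realpow ln_div field_simps)
  qed
  then show "\<forall>\<^sub>F n in sequentially. ereal (1 / real n * ln (a_inf d f t x n)) \<le> ereal (- ln k)"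
    using eventually_gt_at_top[of "0::nat"] by (rule eventually_mono[rotated])
qed

lemma max_exponent_ge: "ereal (ln k) \<le> max_exponent d f x"
proof -
  \<comment> \<open>The exponent decreases with the scale, so its limit is an infimum and inherits
    the lower bound valid at every scale.\<close>
  have "max_exponent d f x = (INF t\<in>{0<..}. max_exponent_at d f t x)"
    unfolding max_exponent_def
    by (intro tendsto_Lim mono_on_tendsto_at_right_INF max_exponent_at_mono) simp_all
  then show ?thesis by (simp add: le_INF_iff max_exponent_at_ge)
qed

lemma min_exponent_le: "min_exponent d f x \<le> ereal (- ln k)"
proof -
  \<comment> \<open>Here shrinking the scale increases the exponent, so the limit is a supremum of
    values bounded by \<open>- ln k\<close>.\<close>
  have "min_exponent d f x = (SUP t\<in>{0<..}. min_exponent_at d f t x)"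
    unfolding min_exponent_def
    by (intro tendsto_Lim antimono_on_tendsto_at_right_SUP min_exponent_at_antimono) simp_all
  then show ?thesis using min_exponent_at_le by (auto intro: SUP_least)
qed

end

theorem theorem2p5:
  fixes f :: "'a::{metric_space, perfect_space} \<Rightarrow> 'a"
    and m :: "'a metric"
    and k \<epsilon>\<^sub>0 \<gamma> :: real
  assumes "compact (UNIV :: 'a set)"
    and "connected (UNIV :: 'a set)"
    and "locally connected (UNIV :: 'a set)"
    and "homeomorphism UNIV UNIV f (inv f)"
    and "expansive f"
    and "mspace m = UNIV"
    and "mtopology_of m = euclidean"
    and "k > 1"
    and "\<epsilon>\<^sub>0 > 0"
    and "Lipschitz_continuous_map m m f"
    and "Lipschitz_continuous_map m m (inv f)"
    and "\<forall>x y. max (mdist m (f x) (f y)) (mdist m (inv f x) (inv f y))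
               \<ge> min (k * mdist m x y) \<epsilon>\<^sub>0"
    and "\<gamma> = ln k"
  shows "\<forall>x. max_exponent (mdist m) f x \<ge> ereal \<gamma> \<and>
             min_exponent (mdist m) f x \<le> ereal (- \<gamma>)"
proof -
  \<comment> \<open>The role of \<open>g\<close> is taken by \<open>inv f\<close>;
    \<open>homeomorphism\<close> supplies both cancellation laws and both continuities.\<close>
  have "hyperbolic_homeo m f (inv f) k \<epsilon>\<^sub>0"
    using assms by unfold_locales (auto simp: homeomorphism_def)
  then interpret lipschitz_hyperbolic_homeo m f "inv f" k \<epsilon>\<^sub>0
    using assms by (intro lipschitz_hyperbolic_homeo.intro lipschitz_hyperbolic_homeo_axioms.intro)
  show ?thesis
    using max_exponent_ge min_exponent_le \<open>\<gamma> = ln k\<close> by simp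
qed

end
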